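(* Let $G$ be an abelian group and let $\varphi\in\mathrm{End}(G)$. The following conditions are equivalent: (i) $s(\varphi)>0$; (ii) $s(\varphi)=\infty$; (iii) $\mathrm{sc}(\varphi)\not\subseteq \mathrm{Per}(\varphi)$.
   Context: $\mathbb N=\{0,1,2,\dots\}$ and $\mathbb N_+=\mathbb N\setminus\{0\}$. Let $\lambda:\Gamma\to\Gamma$ be a self-map of a set $\Gamma$. A point $x\in\Gamma$ is periodic if $\lambda^n(x)=x$ for some $n\in\mathbb N_+$; $\mathrm{Per}(\lambda)$ is the set of periodic points. A string of $\lambda$ is a sequence $S=\{x_n\}_{n\in\mathbb N}$ of pairwise distinct elements of $\Gamma$ with $\lambda(x_n)=x_{n-1}$ for every $n\in\mathbb N_+$. The string number is $s(\lambda)=\sup\{|\mathcal F|:\mathcal F$ is a family of pairwise disjoint strings of $\lambda$ in $\Gamma\}$ (disjointness refers to the underlying sets of elements); it takes values in $\mathbb N\cup\{\infty\}$, i.e. it is set equal to $\infty$ whenever the supremum is infinite. The surjective core $\mathrm{sc}(\lambda)$ is the largest subset $\Lambda\subseteq\Gamma$ with $\lambda(\Lambda)=\Lambda$ (it always exists, and it is a subgroup when $\lambda$ is a group endomorphism). *)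

theory Defs
  imports "HOL-Algebra.Group" "HOL-Library.Extended_Nat" "HOL-Library.Disjoint_Sets"
begin

text \<open>A self-map of a set \<open>\<Gamma>\<close> is a function \<open>f\<close> with \<open>f \<in> \<Gamma> \<rightarrow> \<Gamma>\<close>; its values outside
  \<open>\<Gamma>\<close> are irrelevant to all of the following notions.\<close>

definition Per :: "'a set \<Rightarrow> ('a \<Rightarrow> 'a) \<Rightarrow> 'a set" where
  "Per \<Gamma> f = {x \<in> \<Gamma>. \<exists>n>0. (f ^^ n) x = x}"

definition is_string :: "'a set \<Rightarrow> ('a \<Rightarrow> 'a) \<Rightarrow> (nat \<Rightarrow> 'a) \<Rightarrow> bool" where
  "is_string \<Gamma> f x \<longleftrightarrow> range x \<subseteq> \<Gamma> \<and> inj x \<and> (\<forall>n>0. f (x n) = x (n - 1))"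

definition ecard :: "'a set \<Rightarrow> enat" where
  "ecard A = (if finite A then enat (card A) else \<infinity>)"

text \<open>Strings are non-empty, so a pairwise disjoint family has no repetitions and may be taken to be
  a set of sequences.\<close>

definition string_number :: "'a set \<Rightarrow> ('a \<Rightarrow> 'a) \<Rightarrow> enat" where
  "string_number \<Gamma> f =
    Sup {ecard F |F. (\<forall>x\<in>F. is_string \<Gamma> f x) \<and> disjoint_family_on range F}"

definition surjective_core :: "'a set \<Rightarrow> ('a \<Rightarrow> 'a) \<Rightarrow> 'a set" where
  "surjective_core \<Gamma> f = (GREATEST \<Lambda>. \<Lambda> \<subseteq> \<Gamma> \<and> f ` \<Lambda> = \<Lambda>)"

text \<open>The greatest such subset always exists, namely the union of all of them.\<close>

lemma image_Union_surjective:
  "f ` \<Union>{\<Lambda>. \<Lambda> \<subseteq> \<Gamma> \<and> f ` \<Lambda> = \<Lambda>} = \<Union>{\<Lambda>. \<Lambda> \<subseteq> \<Gamma> \<and> f ` \<Lambda> = \<Lambda>}"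
proof -
  have "(\<lambda>\<Lambda>. f ` \<Lambda>) ` {\<Lambda>. \<Lambda> \<subseteq> \<Gamma> \<and> f ` \<Lambda> = \<Lambda>} = (\<lambda>\<Lambda>. \<Lambda>) ` {\<Lambda>. \<Lambda> \<subseteq> \<Gamma> \<and> f ` \<Lambda> = \<Lambda>}"
    by (rule image_cong[OF refl], drule CollectD, erule conjunct2)
  then show ?thesis
    unfolding image_Union by (simp only: image_ident)
qed

lemma surjective_core_eq_Union: "surjective_core \<Gamma> f = \<Union>{\<Lambda>. \<Lambda> \<subseteq> \<Gamma> \<and> f ` \<Lambda> = \<Lambda>}"
  unfolding surjective_core_def
proof (rule Greatest_equality)
  show "\<Union>{\<Lambda>. \<Lambda> \<subseteq> \<Gamma> \<and> f ` \<Lambda> = \<Lambda>} \<subseteq> \<Gamma>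
      \<and> f ` \<Union>{\<Lambda>. \<Lambda> \<subseteq> \<Gamma> \<and> f ` \<Lambda> = \<Lambda>} = \<Union>{\<Lambda>. \<Lambda> \<subseteq> \<Gamma> \<and> f ` \<Lambda> = \<Lambda>}"
    by (intro conjI image_Union_surjective Union_least, drule CollectD, erule conjunct1)
  show "\<Lambda> \<subseteq> \<Union>{\<Lambda>. \<Lambda> \<subseteq> \<Gamma> \<and> f ` \<Lambda> = \<Lambda>}" if "\<Lambda> \<subseteq> \<Gamma> \<and> f ` \<Lambda> = \<Lambda>" for \<Lambda>
    by (rule Union_upper, rule CollectI, rule that)
qed

lemma surjective_core_subset: "surjective_core \<Gamma> f \<subseteq> \<Gamma>"
  unfolding surjective_core_eq_Union
  by (intro Union_least, drule CollectD, erule conjunct1)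

lemma image_surjective_core: "f ` surjective_core \<Gamma> f = surjective_core \<Gamma> f"
  unfolding surjective_core_eq_Union by (rule image_Union_surjective)

lemma surjective_core_greatest:
  assumes "\<Lambda> \<subseteq> \<Gamma>" and "f ` \<Lambda> = \<Lambda>"
  shows "\<Lambda> \<subseteq> surjective_core \<Gamma> f"
  unfolding surjective_core_eq_Union
  by (rule Union_upper, rule CollectI, intro conjI assms)

end

theory Submission
  imports Defs "HOL-Algebra.Multiplicative_Group"
begin

text \<open>
A backward sequence \<open>x\<close> with \<open>f (x (n + 1)) = x n\<close> is called a \<^emph>\<open>thread\<close>. The surjective core consists of
the initial points of threads, so it has a point outside \<open>Per\<close> exactly when some thread meets the
complement of \<open>Per\<close>. Such a thread has left \<open>Per\<close> for good from some index on, and from there it is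
injective, hence a string; conversely a string is a thread that cannot stay in \<open>Per\<close>, because the
cycle through its initial point is finite. This gives the equivalence of \<open>s > 0\<close> with the
condition on the surjective core, for arbitrary self-maps.

For infinitely many strings the group structure is needed. The threads form an abelian group \<open>L\<close>
under pointwise multiplication, on which \<open>t x = f \<circ> x\<close> is an injective endomorphism. A thread
meets the complement of \<open>Per\<close> exactly when no \<open>t ^^ p\<close> with \<open>p > 0\<close> fixes it (it is \<^emph>\<open>aperiodic\<close>), and two
aperiodic threads have disjoint tails unless they lie in the same orbit of \<open>t\<close>
(\<open>tails_disjoint_or_same_orbit\<close>). So it suffices to show that one aperiodic element of \<open>L\<close> forces
infinitely many orbits of aperiodic elements (\<open>infinitely_many_aperiodic_orbits\<close>). Suppose that there are
only finitely many; there are two steps, written additively here.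

First, an aperiodic \<open>x\<close> of finite order is impossible. All \<open>x + t\<^sup>i x\<close> with \<open>i > 0\<close> are aperiodic, so
two of them share an orbit, \<open>t\<^sup>m (x + t\<^sup>i x) = t\<^sup>n (x + t\<^sup>j x)\<close>. The top power of \<open>t\<close> occurs in this relation
only once, so it expresses some \<open>t\<^sup>d x\<close> through lower powers. The subgroup
generated by the orbit of \<open>x\<close> is then generated by finitely many elements of finite order, hence
finite, and \<open>x\<close> is periodic.

Secondly, let \<open>a\<close> be aperiodic. By the first step, every element of finite order is
periodic, and this makes all nonzero multiples of \<open>a\<close> aperiodic. Among the multiples \<open>2\<^sup>i a\<close> two
lie in the same orbit, which says that \<open>t\<close> acts on \<open>a\<close> up to torsion like a root of a power of \<open>2\<close>; the
multiples \<open>3\<^sup>i a\<close> say the same with \<open>3\<close>. Eliminating \<open>t\<close> between the two relations gives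
\<open>u a = v a\<close> with \<open>u \<noteq> v\<close>, so \<open>a\<close> has finite order, a contradiction.
\<close>

section \<open>Finitely generated torsion subgroups of abelian groups\<close>

lemma (in comm_group) finite_generate_finite_order:
  assumes "finite S" and "S \<subseteq> carrier G" and "\<And>x. x \<in> S \<Longrightarrow> ord x \<noteq> 0"
  shows "finite (generate G S)"
  using assms
proof (induction S)
  case empty
  then show ?case by (simp add: generate_empty)
next
  case (insert x S)
  have sub: "subgroup (generate G {x}) G" "subgroup (generate G S) G"
    using insert.prems by (auto intro: generate_is_subgroup)
  have x: "x \<in> carrier G" using insert.prems by simp
  have "generate G (insert x S) \<subseteq> generate G {x} <#> generate G S"
  proof (rule generate_subgroup_incl)
    show "insert x S \<subseteq> generate G {x} <#> generate G S"
    proof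
      fix y assume y: "y \<in> insert x S"
      then have yG: "y \<in> carrier G" using insert.prems by auto
      from y show "y \<in> generate G {x} <#> generate G S"
      proof
        assume "y = x"
        then have "y = x \<otimes> \<one>" using x by simp
        then show ?thesis
          unfolding set_mult_def by (blast intro: generate.incl generate.one)
      next
        assume "y \<in> S"
        moreover have "y = \<one> \<otimes> y" using yG by simp
        ultimately show ?thesis
          unfolding set_mult_def by (blast intro: generate.incl generate.one)
      qed
    qed
    show "subgroup (generate G {x} <#> generate G S) G"
      using sub by (rule mult_subgroups)
  qed
  moreover have "finite (generate G {x})"
    using generate_pow_card[OF x] insert.prems(2)[of x] by (auto intro: card_ge_0_finite)
  then have "finite (generate G {x} <#> generate G S)"
    using insert unfolding set_mult_def by auto
  ultimately show ?case by (rule finite_subset)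
qed

lemma (in group) nat_pow_eq_iff:
  assumes "x \<in> carrier G" and "ord x = 0"
  shows "x [^] (m::nat) = x [^] (n::nat) \<longleftrightarrow> m = n"
  using assms infinite_cyclic_subgroup infinite_cyclic_subgroup_order by metis

section \<open>Orbits of an injective endomorphism of an abelian group\<close>

locale injective_endomorphism = comm_group +
  fixes t :: "'a \<Rightarrow> 'a"
  assumes hom: "t \<in> hom G G" and inj: "inj_on t (carrier G)"
begin

definition aperiodic :: "'a \<Rightarrow> bool" where
  "aperiodic x \<longleftrightarrow> x \<in> carrier G \<and> (\<forall>n>0. (t ^^ n) x \<noteq> x)"

text \<open>Since \<open>t\<close> need not be surjective, two elements are compared after moving both forward. For
bijective \<open>t\<close> this is the usual orbit relation.\<close>

definition same_orbit :: "'a \<Rightarrow> 'a \<Rightarrow> bool" where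
  "same_orbit x y \<longleftrightarrow> (\<exists>m n. (t ^^ m) x = (t ^^ n) y)"

definition orbit_span :: "'a \<Rightarrow> nat \<Rightarrow> 'a set" where
  "orbit_span x d = generate G ((\<lambda>i. (t ^^ i) x) ` {..<d})"

lemma funpow_hom: "t ^^ n \<in> hom G G"
proof (induction n)
  case (Suc n)
  then show ?case using hom by (simp add: hom_def Pi_iff)
qed (simp add: hom_def)

lemma funpow_closed [simp]: "x \<in> carrier G \<Longrightarrow> (t ^^ n) x \<in> carrier G"
  using funpow_hom[of n] by (rule hom_in_carrier)

lemma funpow_mult:
  "x \<in> carrier G \<Longrightarrow> y \<in> carrier G \<Longrightarrow> (t ^^ n) (x \<otimes> y) = (t ^^ n) x \<otimes> (t ^^ n) y"
  using funpow_hom[of n] by (rule hom_mult)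

lemma funpow_nat_pow:
  "x \<in> carrier G \<Longrightarrow> (t ^^ n) (x [^] (k::nat)) = (t ^^ n) x [^] k"
  using funpow_hom[of n] by (simp add: hom_nat_pow)

lemma funpow_eq_iff:
  assumes "x \<in> carrier G" and "y \<in> carrier G"
  shows "(t ^^ n) x = (t ^^ n) y \<longleftrightarrow> x = y"
  using assms by (induction n) (auto simp: inj_on_eq_iff[OF inj])

lemma funpow_apply_funpow: "(t ^^ m) ((t ^^ n) x) = (t ^^ (m + n)) x"
  by (simp add: funpow_add)

lemma aperiodic_funpow_eq_iff:
  assumes "aperiodic x"
  shows "(t ^^ m) x = (t ^^ n) x \<longleftrightarrow> m = n"
proof -
  have x: "x \<in> carrier G" using assms by (simp add: aperiodic_def)
  have *: "(t ^^ m) x \<noteq> (t ^^ n) x" if "m < n" for m n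
  proof
    assume "(t ^^ m) x = (t ^^ n) x"
    moreover have "(t ^^ n) x = (t ^^ m) ((t ^^ (n - m)) x)"
      using that by (simp add: funpow_apply_funpow)
    ultimately have "(t ^^ (n - m)) x = x"
      using x by (metis funpow_eq_iff funpow_closed)
    then show False using assms that unfolding aperiodic_def by (meson zero_less_diff)
  qed
  show ?thesis by (metis * linorder_neq_iff)
qed

text \<open>An injective map cannot make an orbit enter a cycle from outside. It is enough to look at a
subsequence of the orbit, which is what the translates in \<open>aperiodic_nat_pow\<close> provide.\<close>

lemma not_aperiodic_if_finite_orbit:
  assumes "finite S" and "p > 0" and "\<And>i. (t ^^ (p * i)) x \<in> S"
  shows "\<not> aperiodic x"
proof
  assume "aperiodic x"
  then have "inj (\<lambda>i. (t ^^ (p * i)) x)"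
    using assms(2) by (auto simp: inj_on_def aperiodic_funpow_eq_iff)
  moreover have "finite (range (\<lambda>i. (t ^^ (p * i)) x))"
    using assms(1,3) by (meson finite_subset image_subsetI)
  ultimately show False using finite_imageD by blast
qed

lemma subgroup_orbit_span: "x \<in> carrier G \<Longrightarrow> subgroup (orbit_span x d) G"
  unfolding orbit_span_def by (rule generate_is_subgroup) auto

lemma funpow_in_orbit_span: "i < d \<Longrightarrow> (t ^^ i) x \<in> orbit_span x d"
  unfolding orbit_span_def by (auto intro: generate.incl)

text \<open>A relation that expresses one power of \<open>t\<close> at \<open>x\<close> through lower powers makes the span of the
lower powers stable under \<open>t\<close>, as for the companion matrix of a monic polynomial.\<close>

lemma funpow_orbit_span_closed:
  assumes x: "x \<in> carrier G" and d: "(t ^^ d) x \<in> orbit_span x d" and y: "y \<in> orbit_span x d"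
  shows "(t ^^ n) y \<in> orbit_span x d"
proof (induction n)
  case (Suc n)
  interpret t: group_hom G G t
    using hom by (simp add: group_hom_def group_hom_axioms_def)
  have "t ` orbit_span x d = generate G ((\<lambda>i. (t ^^ Suc i) x) ` {..<d})"
    unfolding orbit_span_def using x by (subst t.generate_img[symmetric]) (auto simp: image_image)
  also have "\<dots> \<subseteq> orbit_span x d"
  proof (rule generate_subgroup_incl[OF _ subgroup_orbit_span[OF x]])
    show "(\<lambda>i. (t ^^ Suc i) x) ` {..<d} \<subseteq> orbit_span x d"
    proof clarify
      fix i assume "i < d"
      then consider "Suc i < d" | "Suc i = d" by linarith
      then show "(t ^^ Suc i) x \<in> orbit_span x d"
        by cases (simp_all only: funpow_in_orbit_span d)
    qed
  qed
  finally show ?case using Suc by auto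
qed (simp add: y)

lemma funpow_in_orbit_span_all:
  assumes "x \<in> carrier G" and "(t ^^ d) x \<in> orbit_span x d"
  shows "(t ^^ n) x \<in> orbit_span x d"
proof -
  have "x \<in> orbit_span x d"
    using assms funpow_in_orbit_span[of 0 d x] by (cases d) auto
  then show ?thesis by (rule funpow_orbit_span_closed[OF assms])
qed

lemma ord_funpow:
  assumes "x \<in> carrier G" shows "ord ((t ^^ n) x) = ord x"
proof -
  have "(t ^^ n) \<one> = \<one>"
    using funpow_hom[of n] by (simp add: hom_one)
  then have "(t ^^ n) x [^] k = \<one> \<longleftrightarrow> x [^] k = \<one>" for k :: nat
    using assms by (metis funpow_eq_iff funpow_nat_pow nat_pow_closed one_closed)
  then show ?thesis
    using assms by (simp add: ord_unique pow_eq_id)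
qed

lemma finite_orbit_span:
  assumes "x \<in> carrier G" and "ord x \<noteq> 0"
  shows "finite (orbit_span x d)"
  unfolding orbit_span_def
  using assms by (intro finite_generate_finite_order) (auto simp: ord_funpow)

text \<open>Otherwise the whole orbit of \<open>x\<close> would lie in a finite group.\<close>

lemma aperiodic_finite_order_independent:
  assumes "aperiodic x" and "ord x \<noteq> 0"
  shows "(t ^^ d) x \<notin> orbit_span x d"
proof
  assume d: "(t ^^ d) x \<in> orbit_span x d"
  have x: "x \<in> carrier G" using assms(1) by (simp add: aperiodic_def)
  have "\<not> aperiodic x"
    by (rule not_aperiodic_if_finite_orbit[of "orbit_span x d" 1])
      (use finite_orbit_span[OF x assms(2)] funpow_in_orbit_span_all[OF x d] in auto)
  then show False using assms(1) by contradiction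
qed

lemma in_orbit_span_if_relation:
  assumes x: "x \<in> carrier G" and less: "i < d" "j < d" "k < d"
    and eq: "(t ^^ i) x \<otimes> (t ^^ d) x = (t ^^ j) x \<otimes> (t ^^ k) x"
  shows "(t ^^ d) x \<in> orbit_span x d"
proof -
  have sub: "subgroup (orbit_span x d) G" using x by (rule subgroup_orbit_span)
  have "(t ^^ d) x = inv ((t ^^ i) x) \<otimes> ((t ^^ j) x \<otimes> (t ^^ k) x)"
    using x eq by (simp only: inv_solve_left m_closed funpow_closed)
  also have "\<dots> \<in> orbit_span x d"
    using less by (intro subgroup.m_closed[OF sub] subgroup.m_inv_closed[OF sub] funpow_in_orbit_span)
  finally show ?thesis .
qed

text \<open>If \<open>t ^^ m\<close> of the first product equals \<open>t ^^ n\<close> of the second, then \<open>m + i = n + j\<close>: otherwise the higher of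
these two powers of \<open>t\<close> at \<open>x\<close> would be expressed through lower ones. The top terms cancel, and
the lower terms give \<open>m = n\<close> by aperiodicity.\<close>

lemma not_same_orbit_mult_shift:
  assumes "aperiodic x" and "ord x \<noteq> 0" and "i \<noteq> j" and "i > 0" and "j > 0"
  shows "\<not> same_orbit (x \<otimes> (t ^^ i) x) (x \<otimes> (t ^^ j) x)"
proof
  assume "same_orbit (x \<otimes> (t ^^ i) x) (x \<otimes> (t ^^ j) x)"
  then obtain m n where "(t ^^ m) (x \<otimes> (t ^^ i) x) = (t ^^ n) (x \<otimes> (t ^^ j) x)"
    unfolding same_orbit_def by blast
  moreover have x: "x \<in> carrier G" using assms(1) by (simp add: aperiodic_def)
  ultimately have eq:
    "(t ^^ m) x \<otimes> (t ^^ (m + i)) x = (t ^^ n) x \<otimes> (t ^^ (n + j)) x"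
    by (simp add: funpow_mult funpow_apply_funpow)
  consider "n + j < m + i" | "m + i < n + j" | "m + i = n + j" by linarith
  then show False
  proof cases
    case 1
    then show False
      using in_orbit_span_if_relation[OF x _ _ _ eq] aperiodic_finite_order_independent assms by simp
  next
    case 2
    then show False
      using in_orbit_span_if_relation[OF x _ _ _ eq[symmetric]]
        aperiodic_finite_order_independent assms by simp
  next
    case 3
    have "(t ^^ m) x = (t ^^ n) x"
      using eq x unfolding 3 by (simp only: right_cancel funpow_closed)
    then show False using 3 assms by (simp add: aperiodic_funpow_eq_iff)
  qed
qed

text \<open>If \<open>t ^^ p\<close> fixed the product, \<open>(t ^^ (p + i)) x\<close> would be expressed through lower powers of \<open>t\<close> at \<open>x\<close>.\<close>

lemma aperiodic_mult_shift:
  assumes "aperiodic x" and "ord x \<noteq> 0" and "i > 0"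
  shows "aperiodic (x \<otimes> (t ^^ i) x)"
proof -
  have x: "x \<in> carrier G" using assms(1) by (simp add: aperiodic_def)
  have "(t ^^ p) (x \<otimes> (t ^^ i) x) \<noteq> x \<otimes> (t ^^ i) x" if "p > 0" for p
  proof
    assume "(t ^^ p) (x \<otimes> (t ^^ i) x) = x \<otimes> (t ^^ i) x"
    then have "(t ^^ p) x \<otimes> (t ^^ (p + i)) x = (t ^^ 0) x \<otimes> (t ^^ i) x"
      using x by (simp add: funpow_mult funpow_apply_funpow)
    then have "(t ^^ (p + i)) x \<in> orbit_span x (p + i)"
      by (rule in_orbit_span_if_relation[OF x, rotated 3]) (use that assms(3) in auto)
    then show False using aperiodic_finite_order_independent[OF assms(1,2)] by contradiction
  qed
  then show ?thesis using x by (simp add: aperiodic_def)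
qed

text \<open>Let \<open>t ^^ p\<close> fix the power of \<open>a\<close>. Then \<open>(t ^^ p) a = a \<otimes> b\<close> with \<open>b\<close> of finite order, hence periodic
by hypothesis. So \<open>t ^^ p\<close> moves \<open>a\<close> only within its coset of the finite \<open>t\<close>-stable group spanned
by the orbit of \<open>b\<close>.\<close>

lemma aperiodic_nat_pow:
  assumes torsion: "\<And>y. aperiodic y \<Longrightarrow> ord y = 0"
    and a: "aperiodic a" and k: "k > 0"
  shows "aperiodic (a [^] (k::nat))"
proof -
  have aG: "a \<in> carrier G" using a by (simp add: aperiodic_def)
  have False if p: "p > 0" and eq: "(t ^^ p) (a [^] k) = a [^] k" for p
  proof -
    define b where "b = inv a \<otimes> (t ^^ p) a"
    have b: "b \<in> carrier G" using aG by (simp add: b_def)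
    have ta: "(t ^^ p) a = a \<otimes> b" using aG by (simp add: b_def m_assoc[symmetric])
    have "b [^] k = \<one>"
      using aG eq unfolding b_def
      by (simp add: nat_pow_distrib funpow_nat_pow nat_pow_inv)
    then have ord: "ord b \<noteq> 0" using b k by (auto simp: ord_eq_0)
    then have "\<not> aperiodic b" by (rule contrapos_nn) (rule torsion)
    then obtain q where q: "q > 0" "(t ^^ q) b = b" using b unfolding aperiodic_def by auto
    have bK: "b \<in> orbit_span b q" using funpow_in_orbit_span[OF q(1), of b] by simp
    then have per: "(t ^^ q) b \<in> orbit_span b q" by (simp only: q(2))
    have K: "subgroup (orbit_span b q) G" using b by (rule subgroup_orbit_span)
    have "(t ^^ (p * i)) a \<in> (\<lambda>c. a \<otimes> c) ` orbit_span b q" for i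
    proof (induction i)
      case 0
      have "a = a \<otimes> \<one>" using aG by simp
      then show ?case using subgroup.one_closed[OF K] by auto
    next
      case (Suc i)
      then obtain c where c: "(t ^^ (p * i)) a = a \<otimes> c" "c \<in> orbit_span b q" by blast
      have "(t ^^ (p * Suc i)) a = (t ^^ p) (a \<otimes> c)"
        by (simp add: c(1)[symmetric] funpow_apply_funpow)
      also have "\<dots> = a \<otimes> (b \<otimes> (t ^^ p) c)"
        using aG b subgroup.mem_carrier[OF K c(2)] by (simp add: funpow_mult ta m_assoc)
      finally have "(t ^^ (p * Suc i)) a = a \<otimes> (b \<otimes> (t ^^ p) c)" .
      moreover have "b \<otimes> (t ^^ p) c \<in> orbit_span b q"
        using bK funpow_orbit_span_closed[OF b per c(2)] by (rule subgroup.m_closed[OF K])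
      ultimately show ?case by blast
    qed
    then have "\<not> aperiodic a"
      by (rule not_aperiodic_if_finite_orbit[OF finite_imageI[OF finite_orbit_span[OF b ord]] p])
    then show False using a by contradiction
  qed
  then show ?thesis using aG by (auto simp: aperiodic_def)
qed

text \<open>In additive notation this is \<open>k t\<^sup>m x = l t\<^sup>n x\<close>. The relations satisfied by a fixed \<open>x\<close> can be multiplied,
raised to powers and reversed, like fractions \<open>k t\<^sup>m / (l t\<^sup>n)\<close> equal to one.\<close>

definition pow_relation :: "'a \<Rightarrow> nat \<Rightarrow> nat \<Rightarrow> nat \<Rightarrow> nat \<Rightarrow> bool" where
  "pow_relation x k m l n \<longleftrightarrow> (t ^^ m) x [^] k = (t ^^ n) x [^] l"

lemma pow_relation_sym: "pow_relation x k m l n \<Longrightarrow> pow_relation x l n k m"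
  by (simp add: pow_relation_def)

lemma pow_relation_mult:
  assumes x: "x \<in> carrier G" and "pow_relation x k m l n" and "pow_relation x k' m' l' n'"
  shows "pow_relation x (k * k') (m + m') (l * l') (n + n')"
proof -
  have *: "(t ^^ (i + j)) x [^] (u * v) = (t ^^ j) ((t ^^ i) x [^] u) [^] v" for i j u v :: nat
    using x by (simp add: funpow_nat_pow funpow_apply_funpow nat_pow_pow add.commute)
  have "(t ^^ (m + m')) x [^] (k * k') = (t ^^ m') ((t ^^ n) x [^] l) [^] k'"
    using assms(2) by (simp add: * pow_relation_def)
  also have "\<dots> = (t ^^ (m' + n)) x [^] (k' * l)"
    by (simp add: *[symmetric] add.commute mult.commute)
  also have "\<dots> = (t ^^ n) ((t ^^ n') x [^] l') [^] l"
    using assms(3) by (simp add: * pow_relation_def)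
  also have "\<dots> = (t ^^ (n + n')) x [^] (l * l')"
    by (simp add: *[symmetric] add.commute mult.commute)
  finally show ?thesis by (simp add: pow_relation_def)
qed

lemma pow_relation_power:
  assumes "x \<in> carrier G" and "pow_relation x k m l n"
  shows "pow_relation x (k ^ s) (m * s) (l ^ s) (n * s)"
proof (induction s)
  case (Suc s)
  then show ?case using pow_relation_mult[OF assms(1,2) Suc] by simp
qed (simp add: pow_relation_def)

lemma pow_relation_same_shift:
  assumes "x \<in> carrier G" and "ord x = 0" and "pow_relation x k m l m"
  shows "k = l"
  using assms nat_pow_eq_iff[of "(t ^^ m) x" k l] by (simp add: pow_relation_def ord_funpow)

end

lemma two_three_power_eq_iff:
  fixes a b c d :: nat
  shows "2 ^ a * 3 ^ b = (2::nat) ^ c * 3 ^ d \<longleftrightarrow> a = c \<and> b = d"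
proof -
  have le: "a \<le> c \<and> b \<le> d" if "2 ^ a * 3 ^ b = (2::nat) ^ c * 3 ^ d" for a b c d :: nat
  proof -
    have "coprime ((2::nat) ^ a) (3 ^ d)" "coprime ((3::nat) ^ b) (2 ^ c)" by simp_all
    moreover have "(2::nat) ^ a dvd 2 ^ c * 3 ^ d" "(3::nat) ^ b dvd 2 ^ c * 3 ^ d"
      by (metis that dvd_triv_left, metis that dvd_triv_right)
    ultimately have "(2::nat) ^ a dvd 2 ^ c" "(3::nat) ^ b dvd 3 ^ d"
      by (simp_all add: coprime_dvd_mult_left_iff coprime_dvd_mult_right_iff)
    then show ?thesis by (auto dest: power_dvd_imp_le)
  qed
  show ?thesis using le[of a b c d] le[of c d a b] by auto
qed

text \<open>The exponents of \<open>t\<close> in two relations differ by \<open>n - m\<close> and \<open>n' - m'\<close>. Raising the relations to the powers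
\<open>r = \<bar>n' - m'\<bar>\<close> and \<open>s = \<bar>n - m\<bar>\<close> makes these differences equal up to sign. The sign decides whether the
relations are multiplied directly or with the second one reversed, so both combinations appear.
If \<open>m = n\<close>, the first relation suffices.\<close>

lemma balanced_multiples:
  fixes m n m' n' :: nat
  obtains r s where "r > 0 \<or> s > 0"
    and "m * r + m' * s = n * r + n' * s \<or> m * r + n' * s = n * r + m' * s"
proof (cases "m = n")
  case True
  then show thesis using that[of 1 0] by simp
next
  case False
  define r s where "r = nat \<bar>int n' - int m'\<bar>" and "s = nat \<bar>int n - int m\<bar>"
  have "(int n - int m) * int r = (int n' - int m') * int s
      \<or> (int n - int m) * int r = - ((int n' - int m') * int s)"
    by (auto simp: r_def s_def abs_if algebra_simps)
  then have "int (m * r + m' * s) = int (n * r + n' * s) \<or> int (m * r + n' * s) = int (n * r + m' * s)"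
    by (auto simp: algebra_simps)
  then show thesis using that[of r s] False by (simp only: of_nat_eq_iff) (auto simp: s_def)
qed

context injective_endomorphism
begin

text \<open>The relations are combined so that \<open>t\<close> occurs to the same power on both sides and can be
cancelled by injectivity. As powers of \<open>2\<close> and \<open>3\<close> are multiplicatively independent, the remaining
equality of two multiples of \<open>x\<close> is nontrivial.\<close>

lemma no_independent_pow_relations:
  assumes x: "x \<in> carrier G" and ord: "ord x = 0"
    and two: "pow_relation x (2 ^ i) m (2 ^ j) n" and "i \<noteq> j"
    and three: "pow_relation x (3 ^ i') m' (3 ^ j') n'" and "i' \<noteq> j'"
  shows False
proof -
  obtain r s where rs: "r > 0 \<or> s > 0"
    and "m * r + m' * s = n * r + n' * s \<or> m * r + n' * s = n * r + m' * s"
    by (rule balanced_multiples)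
  from this(2) show False
  proof
    assume eq: "m * r + m' * s = n * r + n' * s"
    have "pow_relation x (2 ^ (i * r) * 3 ^ (i' * s)) (m * r + m' * s)
        (2 ^ (j * r) * 3 ^ (j' * s)) (n * r + n' * s)"
      using pow_relation_mult[OF x pow_relation_power[OF x two, of r] pow_relation_power[OF x three, of s]]
      by (simp only: power_mult)
    then have "2 ^ (i * r) * 3 ^ (i' * s) = (2 ^ (j * r) * 3 ^ (j' * s) :: nat)"
      using pow_relation_same_shift[OF x ord] eq by simp
    then show False using rs assms(4,6) by (simp add: two_three_power_eq_iff)
  next
    assume eq: "m * r + n' * s = n * r + m' * s"
    have "pow_relation x (2 ^ (i * r) * 3 ^ (j' * s)) (m * r + n' * s)
        (2 ^ (j * r) * 3 ^ (i' * s)) (n * r + m' * s)"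
      using pow_relation_mult[OF x pow_relation_power[OF x two, of r]
          pow_relation_power[OF x pow_relation_sym[OF three], of s]]
      by (simp only: power_mult)
    then have "2 ^ (i * r) * 3 ^ (j' * s) = (2 ^ (j * r) * 3 ^ (i' * s) :: nat)"
      using pow_relation_same_shift[OF x ord] eq by simp
    then show False using rs assms(4,6) by (simp add: two_three_power_eq_iff)
  qed
qed

lemma same_orbit_trans:
  assumes "same_orbit x z" and "same_orbit y z"
  shows "same_orbit x y"
proof -
  obtain m n m' n' where eq: "(t ^^ m) x = (t ^^ n) z" "(t ^^ m') y = (t ^^ n') z"
    using assms unfolding same_orbit_def by blast
  have "(t ^^ (n' + m)) x = (t ^^ (n + m')) y"
    by (simp add: funpow_apply_funpow[symmetric] eq) (simp add: funpow_apply_funpow add.commute)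
  then show ?thesis unfolding same_orbit_def by blast
qed

lemma pigeonhole_same_orbit:
  assumes "finite B" and cover: "\<And>y. aperiodic y \<Longrightarrow> \<exists>b\<in>B. same_orbit y b"
    and "\<And>i. aperiodic (c i)"
  obtains i j :: nat where "i \<noteq> j" and "same_orbit (c i) (c j)"
proof -
  obtain b where inf: "infinite {i. same_orbit (c i) b}"
    using pigeonhole_infinite_rel[of "UNIV :: nat set" B "\<lambda>i b. same_orbit (c i) b"] assms by auto
  then obtain i where i: "same_orbit (c i) b" using not_finite_existsD by blast
  have "infinite ({i. same_orbit (c i) b} - {i})" using inf by simp
  then obtain j where "j \<in> {i. same_orbit (c i) b} - {i}" using infinite_imp_nonempty by blast
  then show thesis using that[of i j] same_orbit_trans[OF i, of "c j"] by blast
qed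

text \<open>A finite set \<open>B\<close> of representatives of all aperiodic orbits leads to a contradiction by applying the pigeonhole
principle to the products \<open>y \<otimes> (t ^^ i) y\<close> and to the powers of \<open>a\<close> with exponents \<open>2 ^ i\<close> and
\<open>3 ^ i\<close>.\<close>

lemma infinitely_many_aperiodic_orbits:
  assumes a: "aperiodic a" and "finite B"
  shows "\<exists>y. aperiodic y \<and> (\<forall>b\<in>B. \<not> same_orbit y b)"
proof (rule ccontr)
  assume "\<not> ?thesis"
  then have cover: "\<exists>b\<in>B. same_orbit y b" if "aperiodic y" for y using that by blast
  have torsion: "ord y = 0" if y: "aperiodic y" for y
  proof (rule ccontr)
    assume ord: "ord y \<noteq> 0"
    \<comment> \<open>\<open>Suc i\<close> because the shift in \<open>aperiodic_mult_shift\<close> has to be positive.\<close>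
    obtain i j where "i \<noteq> j" "same_orbit (y \<otimes> (t ^^ Suc i) y) (y \<otimes> (t ^^ Suc j) y)"
      using pigeonhole_same_orbit[of B "\<lambda>i. y \<otimes> (t ^^ Suc i) y"] \<open>finite B\<close> cover
        aperiodic_mult_shift[OF y ord] by blast
    then show False using not_same_orbit_mult_shift[OF y ord, of "Suc i" "Suc j"] by simp
  qed
  have aG: "a \<in> carrier G" using a by (simp add: aperiodic_def)
  have rel: "\<exists>i j m n. i \<noteq> j \<and> pow_relation a (r ^ i) m (r ^ j) n" if "r > 0" for r :: nat
  proof -
    have "aperiodic (a [^] (r ^ i))" for i
      using torsion a that by (intro aperiodic_nat_pow) auto
    then obtain i j where "i \<noteq> j" "same_orbit (a [^] (r ^ i)) (a [^] (r ^ j))"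
      using pigeonhole_same_orbit[of B "\<lambda>i. a [^] (r ^ i)"] \<open>finite B\<close> cover by blast
    then show ?thesis
      using aG unfolding same_orbit_def pow_relation_def by (auto simp: funpow_nat_pow)
  qed
  show False
    using rel[of 2] rel[of 3] no_independent_pow_relations[OF aG torsion[OF a]]
    by (metis zero_less_numeral)
qed

end


lemma (in injective_endomorphism) finite_set_of_aperiodic_orbits:
  assumes "aperiodic a"
  shows "\<exists>C. finite C \<and> card C = k \<and> (\<forall>x\<in>C. aperiodic x)
    \<and> (\<forall>x\<in>C. \<forall>y\<in>C. x \<noteq> y \<longrightarrow> \<not> same_orbit x y)"
proof (induction k)
  case 0
  then show ?case by (intro exI[of _ "{}"]) simp
next
  case (Suc k)
  then obtain C where C: "finite C" "card C = k" "\<forall>x\<in>C. aperiodic x"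
    "\<forall>x\<in>C. \<forall>y\<in>C. x \<noteq> y \<longrightarrow> \<not> same_orbit x y" by blast
  obtain z where z: "aperiodic z" "\<forall>b\<in>C. \<not> same_orbit z b"
    using infinitely_many_aperiodic_orbits[OF assms C(1)] by blast
  have refl: "same_orbit x x" for x unfolding same_orbit_def by blast
  have sym: "same_orbit y x" if "same_orbit x y" for x y
    using that unfolding same_orbit_def by metis
  have "z \<notin> C" using z(2) refl by blast
  then show ?case
    using C z sym by (intro exI[of _ "insert z C"]) auto
qed

section \<open>Threads and strings of a self-map\<close>

definition threads :: "'a set \<Rightarrow> ('a \<Rightarrow> 'a) \<Rightarrow> (nat \<Rightarrow> 'a) set" where
  "threads \<Gamma> f = {x. \<forall>n. x n \<in> \<Gamma> \<and> f (x (Suc n)) = x n}"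

lemma threadsD:
  assumes "x \<in> threads \<Gamma> f"
  shows "x n \<in> \<Gamma>" and "f (x (Suc n)) = x n"
  using assms by (auto simp: threads_def)

lemma funpow_thread:
  assumes "x \<in> threads \<Gamma> f"
  shows "(f ^^ k) (x (n + k)) = x n"
proof (induction k)
  case (Suc k)
  then show ?case using threadsD(2)[OF assms, of "n + k"] by (simp add: funpow_swap1)
qed simp

lemma funpow_thread_le:
  assumes "x \<in> threads \<Gamma> f" and "k \<le> n"
  shows "(f ^^ k) (x n) = x (n - k)"
  using funpow_thread[OF assms(1), of k "n - k"] assms(2) by simp

lemma funpow_funpow_commute: "(f ^^ m) ((f ^^ n) x) = (f ^^ n) ((f ^^ m) x)"
proof -
  have "(f ^^ (m + n)) x = (f ^^ (n + m)) x" by (simp add: add.commute)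
  then show ?thesis by (simp only: funpow_add comp_apply)
qed

lemma tail_in_threads: "x \<in> threads \<Gamma> f \<Longrightarrow> (\<lambda>n. x (N + n)) \<in> threads \<Gamma> f"
  by (simp add: threads_def)

lemma string_in_threads:
  assumes "is_string \<Gamma> f x" shows "x \<in> threads \<Gamma> f"
proof -
  have "f (x (Suc n)) = x n" for n
    using assms unfolding is_string_def by (metis diff_Suc_1 zero_less_Suc)
  then show ?thesis using assms by (auto simp: threads_def is_string_def)
qed

lemma is_string_iff: "is_string \<Gamma> f x \<longleftrightarrow> x \<in> threads \<Gamma> f \<and> inj x"
proof
  assume "x \<in> threads \<Gamma> f \<and> inj x"
  moreover from this have "f (x n) = x (n - 1)" if "n > 0" for n
    using threadsD(2)[of x \<Gamma> f "n - 1"] that by simp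
  ultimately show "is_string \<Gamma> f x"
    by (auto simp: is_string_def dest: threadsD)
qed (auto simp: string_in_threads is_string_def)

text \<open>Surjectivity of \<open>f\<close> on its surjective core allows preimages to be chosen forever. Conversely the
initial points of threads form a set that \<open>f\<close> maps onto itself: dropping the first entry of a thread gives
a thread that starts at a preimage, and \<open>f \<circ> x\<close> is a thread that starts at the image.\<close>

lemma surjective_core_eq_threads:
  assumes f: "f ` \<Gamma> \<subseteq> \<Gamma>"
  shows "surjective_core \<Gamma> f = (\<lambda>x. x 0) ` threads \<Gamma> f"
proof (rule antisym)
  show "surjective_core \<Gamma> f \<subseteq> (\<lambda>x. x 0) ` threads \<Gamma> f"
  proof
    fix a assume a: "a \<in> surjective_core \<Gamma> f"
    have "\<exists>v. v \<in> surjective_core \<Gamma> f \<and> f v = u" if "u \<in> surjective_core \<Gamma> f" for u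
      using that image_surjective_core[of f \<Gamma>] by (metis imageE)
    then obtain x where x: "x 0 = a" "\<And>n. x n \<in> surjective_core \<Gamma> f" "\<And>n. f (x (Suc n)) = x n"
      using dependent_nat_choice[of "\<lambda>n u. u \<in> surjective_core \<Gamma> f \<and> (n = 0 \<longrightarrow> u = a)" "\<lambda>_ u v. f v = u"] a
      by (metis nat.distinct(1))
    then have "x \<in> threads \<Gamma> f"
      using surjective_core_subset[of \<Gamma> f] by (auto simp: threads_def)
    then show "a \<in> (\<lambda>x. x 0) ` threads \<Gamma> f" using x(1) by blast
  qed
  show "(\<lambda>x. x 0) ` threads \<Gamma> f \<subseteq> surjective_core \<Gamma> f"
  proof (rule surjective_core_greatest)
    show "(\<lambda>x. x 0) ` threads \<Gamma> f \<subseteq> \<Gamma>" by (auto dest: threadsD)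
    have "f (x 0) \<in> (\<lambda>x. x 0) ` threads \<Gamma> f" if "x \<in> threads \<Gamma> f" for x
      using that f by (intro image_eqI[of _ _ "\<lambda>n. f (x n)"]) (auto simp: threads_def)
    moreover have "x 0 \<in> f ` (\<lambda>x. x 0) ` threads \<Gamma> f" if "x \<in> threads \<Gamma> f" for x
    proof -
      have "x 0 = f (x (1 + 0))" using threadsD(2)[OF that, of 0] by simp
      moreover have "x (1 + 0) \<in> (\<lambda>x. x 0) ` threads \<Gamma> f"
        using tail_in_threads[OF that, of 1] by (rule rev_image_eqI) (rule refl)
      ultimately show ?thesis by (rule image_eqI)
    qed
    ultimately show "f ` (\<lambda>x. x 0) ` threads \<Gamma> f = (\<lambda>x. x 0) ` threads \<Gamma> f"
      by (intro antisym) (auto simp only: image_subset_iff subset_iff)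
  qed
qed

text \<open>If all entries are periodic, each \<open>x n\<close> lies on the cycle of \<open>x 0\<close>, because going around its own cycle
it passes through \<open>x 0\<close>. So all entries share the period of \<open>x 0\<close>, and \<open>x\<close> is periodic as a sequence.
Once an entry is not periodic no later entry is, since images of periodic points are periodic.\<close>

lemma aperiodic_thread_leaves_Per:
  assumes x: "x \<in> threads \<Gamma> f" and aper: "\<forall>p>0. f ^^ p \<circ> x \<noteq> x"
  obtains N where "\<And>n. n \<ge> N \<Longrightarrow> x n \<notin> Per \<Gamma> f"
proof -
  have "\<exists>N. x N \<notin> Per \<Gamma> f"
  proof (rule ccontr)
    assume "\<not> ?thesis"
    then have per: "\<exists>q>0. (f ^^ q) (x n) = x n" for n by (auto simp: Per_def)
    then obtain p where p: "p > 0" "(f ^^ p) (x 0) = x 0" by blast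
    have "(f ^^ p) (x n) = x n" for n
    proof -
      obtain q where q: "q > 0" "(f ^^ q) (x n) = x n" using per by blast
      \<comment> \<open>Going \<open>n\<close> times around the cycle of \<open>x n\<close> takes at least \<open>n\<close> steps, hence passes \<open>x 0\<close>.\<close>
      have "(f ^^ (q * k)) (x n) = x n" for k
        by (induction k) (simp_all add: funpow_add q(2))
      from this[of n] have "(f ^^ ((q * n - n) + n)) (x n) = x n" using q(1) by simp
      then have eq: "(f ^^ (q * n - n)) (x 0) = x n"
        using funpow_thread[OF x, of n 0] by (simp only: funpow_add comp_apply add_0)
      have "(f ^^ p) (x n) = (f ^^ (q * n - n)) ((f ^^ p) (x 0))"
        unfolding eq[symmetric] by (rule funpow_funpow_commute)
      then show ?thesis by (simp add: p(2) eq)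
    qed
    then show False using aper p(1) by (auto simp: fun_eq_iff)
  qed
  then obtain N where N: "x N \<notin> Per \<Gamma> f" ..
  have "x n \<notin> Per \<Gamma> f" if "n \<ge> N" for n
  proof
    assume "x n \<in> Per \<Gamma> f"
    then obtain q where q: "q > 0" "(f ^^ q) (x n) = x n" by (auto simp: Per_def)
    have xN: "x N = (f ^^ (n - N)) (x n)" using funpow_thread_le[OF x, of "n - N" n] that by simp
    have "(f ^^ q) (x N) = (f ^^ (n - N)) ((f ^^ q) (x n))"
      unfolding xN by (rule funpow_funpow_commute)
    then have "(f ^^ q) (x N) = x N" by (simp add: q(2) xN)
    then show False using N q(1) threadsD(1)[OF x] unfolding Per_def by blast
  qed
  then show thesis by (rule that)
qed

lemma tail_is_string:
  assumes x: "x \<in> threads \<Gamma> f" and aper: "\<And>n. n \<ge> N \<Longrightarrow> x n \<notin> Per \<Gamma> f"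
  shows "is_string \<Gamma> f (\<lambda>n. x (N + n))"
proof -
  have "x (N + i) \<noteq> x (N + j)" if "i < j" for i j
  proof
    assume "x (N + i) = x (N + j)"
    moreover have "(f ^^ (j - i)) (x (N + j)) = x (N + i)"
      using funpow_thread_le[OF x, of "j - i" "N + j"] that by simp
    ultimately have "x (N + j) \<in> Per \<Gamma> f"
      using that threadsD(1)[OF x] by (auto simp: Per_def intro!: exI[of _ "j - i"])
    then show False using aper by simp
  qed
  then have "inj (\<lambda>n. x (N + n))" by (metis (mono_tags, lifting) injI linorder_neqE_nat)
  then show ?thesis using tail_in_threads[OF x] by (simp add: is_string_iff)
qed

text \<open>If the tails keep meeting, any two meeting points \<open>x n0 = y m0\<close> and \<open>x n = y m\<close>, the second one further out, have
the same offset, \<open>n - n0 = m - m0\<close>: both shifts lead from \<open>y m\<close> to \<open>y m0\<close>, which is not periodic.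
As the meeting points go arbitrarily far out, \<open>x\<close> and \<open>y\<close> agree everywhere up to this offset.\<close>

lemma tails_disjoint_or_same_orbit:
  assumes x: "x \<in> threads \<Gamma> f" and y: "y \<in> threads \<Gamma> f"
    and aper: "\<And>n. n \<ge> N \<Longrightarrow> y n \<notin> Per \<Gamma> f"
    and meet: "\<And>M. \<exists>n\<ge>M. \<exists>m\<ge>M. x n = y m"
  obtains m n where "f ^^ m \<circ> x = f ^^ n \<circ> y"
proof -
  obtain n0 m0 where n0: "n0 \<ge> N" and m0: "m0 \<ge> N" and eq0: "x n0 = y m0"
    using meet by blast
  have "(f ^^ m0) (x i) = (f ^^ n0) (y i)" for i
  proof -
    obtain n m where n: "n \<ge> i + n0 + m0" and m: "m \<ge> i + n0 + m0" and eq: "x n = y m"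
      using meet by blast
    have 1: "(f ^^ (n - n0)) (y m) = y m0"
      using funpow_thread_le[OF x, of "n - n0" n] n by (simp add: eq eq0)
    have 2: "(f ^^ (m - m0)) (y m) = y m0"
      using funpow_thread_le[OF y, of "m - m0" m] m by simp
    have *: "a = b"
      if "(f ^^ a) (y m) = y m0" "(f ^^ b) (y m) = y m0" "a \<le> b" for a b
    proof (rule ccontr)
      assume "a \<noteq> b"
      then have "0 < b - a" using that(3) by simp
      moreover have "(f ^^ (b - a)) (y m0) = y m0"
        using that by (metis comp_apply funpow_add le_add_diff_inverse2)
      ultimately have "y m0 \<in> Per \<Gamma> f" using threadsD(1)[OF y] unfolding Per_def by blast
      then show False using aper[OF m0] by contradiction
    qed
    have "n - n0 = m - m0" using *[OF 1 2] *[OF 2 1] by linarith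
    then have same: "m0 + (n - i) = n0 + (m - i)" using n m by linarith
    have "(f ^^ m0) (x i) = (f ^^ (m0 + (n - i))) (x n)"
      using funpow_thread_le[OF x, of "n - i" n] n by (simp only: funpow_add comp_apply) simp
    also have "\<dots> = (f ^^ (n0 + (m - i))) (y m)" by (simp only: same eq)
    also have "\<dots> = (f ^^ n0) (y i)"
      using funpow_thread_le[OF y, of "m - i" m] m by (simp only: funpow_add comp_apply) simp
    finally show ?thesis .
  qed
  then show thesis using that[of m0 n0] by (auto simp: fun_eq_iff)
qed

lemma string_number_ge_card:
  assumes "\<And>x. x \<in> F \<Longrightarrow> is_string \<Gamma> f x" and "disjoint_family_on range F" and "finite F"
  shows "enat (card F) \<le> string_number \<Gamma> f"
  unfolding string_number_def using assms
  by (intro Sup_upper CollectI exI[of _ F]) (auto simp: ecard_def)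

text \<open>Finitely many conditions on tails hold simultaneously from some index on. This limits the argument to finite
families, which suffices because the string number is a supremum.\<close>

lemma card_le_string_number:
  assumes C: "finite C" "C \<subseteq> threads \<Gamma> f"
    and aper: "\<And>x p. x \<in> C \<Longrightarrow> p > 0 \<Longrightarrow> f ^^ p \<circ> x \<noteq> x"
    and indep: "\<And>x y m n. x \<in> C \<Longrightarrow> y \<in> C \<Longrightarrow> x \<noteq> y \<Longrightarrow> f ^^ m \<circ> x \<noteq> f ^^ n \<circ> y"
  shows "enat (card C) \<le> string_number \<Gamma> f"
proof -
  have leave: "\<forall>\<^sub>F N in sequentially. x N \<notin> Per \<Gamma> f" if "x \<in> C" for x
    using aperiodic_thread_leaves_Per[of x \<Gamma> f] that C(2) aper
    by (metis eventually_sequentially subsetD)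
  have "\<forall>\<^sub>F M in sequentially. \<forall>n\<ge>M. \<forall>m\<ge>M. x n \<noteq> y m" if xy: "x \<in> C" "y \<in> C" "x \<noteq> y" for x y
  proof -
    obtain N where N: "\<And>n. n \<ge> N \<Longrightarrow> y n \<notin> Per \<Gamma> f"
      using leave[OF xy(2)] by (auto simp: eventually_sequentially)
    obtain M where "\<forall>n\<ge>M. \<forall>m\<ge>M. x n \<noteq> y m"
      using tails_disjoint_or_same_orbit[of x \<Gamma> f y N] xy C(2) N indep by (metis subsetD)
    then show ?thesis unfolding eventually_sequentially by (meson order_trans)
  qed
  then have "\<forall>\<^sub>F M in sequentially. \<forall>x\<in>C. \<forall>y\<in>C. x \<noteq> y \<longrightarrow> (\<forall>n\<ge>M. \<forall>m\<ge>M. x n \<noteq> y m)"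
    using C(1) by (intro eventually_ball_finite ballI) (auto simp: eventually_mono)
  moreover have "\<forall>\<^sub>F M in sequentially. \<forall>x\<in>C. \<forall>n\<ge>M. x n \<notin> Per \<Gamma> f"
    using C(1) leave by (intro eventually_ball_finite ballI) (auto simp: eventually_all_ge_at_top)
  ultimately have "\<forall>\<^sub>F M in sequentially.
      (\<forall>x\<in>C. \<forall>y\<in>C. x \<noteq> y \<longrightarrow> (\<forall>n\<ge>M. \<forall>m\<ge>M. x n \<noteq> y m))
      \<and> (\<forall>x\<in>C. \<forall>n\<ge>M. x n \<notin> Per \<Gamma> f)"
    by (rule eventually_conj)
  from eventually_happens'[OF sequentially_bot this] obtain M
    where disj: "\<And>x y n m. x \<in> C \<Longrightarrow> y \<in> C \<Longrightarrow> x \<noteq> y \<Longrightarrow> n \<ge> M \<Longrightarrow> m \<ge> M \<Longrightarrow> x n \<noteq> y m"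
      and notin: "\<And>x n. x \<in> C \<Longrightarrow> n \<ge> M \<Longrightarrow> x n \<notin> Per \<Gamma> f"
    by metis
  define tail where "tail x n = x (M + n)" for x :: "nat \<Rightarrow> 'a" and n
  have "inj_on tail C"
    using disj by (auto simp: inj_on_def tail_def fun_eq_iff) (metis le_add1)
  then have "card (tail ` C) = card C" by (rule card_image)
  moreover have "enat (card (tail ` C)) \<le> string_number \<Gamma> f"
  proof (rule string_number_ge_card)
    show "is_string \<Gamma> f s" if "s \<in> tail ` C" for s
      using that tail_is_string[of _ \<Gamma> f M] C(2) notin unfolding tail_def by blast
    show "disjoint_family_on range (tail ` C)"
      using disj by (fastforce simp: disjoint_family_on_def tail_def)
  qed (use C(1) in simp)
  ultimately show ?thesis by simp
qed

section \<open>The group of threads\<close>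

definition thread_group :: "('a, 'b) monoid_scheme \<Rightarrow> ('a \<Rightarrow> 'a) \<Rightarrow> (nat \<Rightarrow> 'a) monoid" where
  "thread_group G f = \<lparr>carrier = threads (carrier G) f,
     mult = (\<lambda>x y n. x n \<otimes>\<^bsub>G\<^esub> y n), one = (\<lambda>n. \<one>\<^bsub>G\<^esub>)\<rparr>"

lemma comm_group_thread_group:
  assumes "comm_group G" and f: "f \<in> hom G G"
  shows "comm_group (thread_group G f)"
proof -
  interpret comm_group G by fact
  interpret f: group_hom G G f
    using f by (simp add: group_hom_def group_hom_axioms_def)
  show ?thesis
  proof (rule comm_groupI)
    fix x assume x: "x \<in> carrier (thread_group G f)"
    have "(\<lambda>n. inv\<^bsub>G\<^esub> x n) \<in> carrier (thread_group G f)"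
      using x by (simp add: thread_group_def threads_def)
    moreover have "(\<lambda>n. inv\<^bsub>G\<^esub> x n) \<otimes>\<^bsub>thread_group G f\<^esub> x = \<one>\<^bsub>thread_group G f\<^esub>"
      using x by (simp add: thread_group_def threads_def)
    ultimately show "\<exists>y\<in>carrier (thread_group G f). y \<otimes>\<^bsub>thread_group G f\<^esub> x = \<one>\<^bsub>thread_group G f\<^esub>"
      by blast
  qed (auto simp: thread_group_def threads_def m_ac)
qed

text \<open>The map is injective although \<open>f\<close> need not be: each entry of a thread is the image of the next one.\<close>

lemma injective_endomorphism_thread_group:
  assumes "comm_group G" and f: "f \<in> hom G G"
  shows "injective_endomorphism (thread_group G f) (\<lambda>x. f \<circ> x)"
proof -
  interpret comm_group G by fact
  interpret L: comm_group "thread_group G f" by (rule comm_group_thread_group[OF assms])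
  interpret f: group_hom G G f
    using f by (simp add: group_hom_def group_hom_axioms_def)
  show ?thesis
  proof
    show "(\<lambda>x. f \<circ> x) \<in> hom (thread_group G f) (thread_group G f)"
      by (auto simp: hom_def thread_group_def threads_def)
    show "inj_on (\<lambda>x. f \<circ> x) (carrier (thread_group G f))"
    proof (rule inj_onI)
      fix x y assume "x \<in> carrier (thread_group G f)" "y \<in> carrier (thread_group G f)"
        and eq: "f \<circ> x = f \<circ> y"
      then have "x \<in> threads (carrier G) f" "y \<in> threads (carrier G) f"
        by (simp_all add: thread_group_def)
      then show "x = y"
        using fun_cong[OF eq] by (auto simp: fun_eq_iff dest: threadsD(2)) (metis threadsD(2))
    qed
  qed
qed

lemma funpow_comp:
  fixes f :: "'a \<Rightarrow> 'a" and x :: "nat \<Rightarrow> 'a"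
  shows "((\<lambda>x. f \<circ> x) ^^ n) x = f ^^ n \<circ> x"
  by (induction n) (simp_all add: o_assoc)

lemma string_number_infinite:
  assumes "comm_group G" and f: "f \<in> hom G G"
    and x: "x \<in> threads (carrier G) f" and aper: "\<forall>p>0. f ^^ p \<circ> x \<noteq> x"
  shows "string_number (carrier G) f = \<infinity>"
proof -
  interpret L: injective_endomorphism "thread_group G f" "\<lambda>x. f \<circ> x"
    using assms(1,2) by (rule injective_endomorphism_thread_group)
  have carrier: "carrier (thread_group G f) = threads (carrier G) f"
    by (simp add: thread_group_def)
  have "L.aperiodic x" using x aper by (simp add: L.aperiodic_def carrier funpow_comp)
  have "enat k \<le> string_number (carrier G) f" for k
  proof -
    obtain C where C: "finite C" "card C = k" "\<forall>x\<in>C. L.aperiodic x"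
      "\<forall>x\<in>C. \<forall>y\<in>C. x \<noteq> y \<longrightarrow> \<not> L.same_orbit x y"
      using L.finite_set_of_aperiodic_orbits[OF \<open>L.aperiodic x\<close>, of k] by blast
    have "enat (card C) \<le> string_number (carrier G) f"
    proof (rule card_le_string_number)
      show "C \<subseteq> threads (carrier G) f" using C(3) by (auto simp: L.aperiodic_def carrier)
    qed (use C in \<open>simp_all add: L.aperiodic_def L.same_orbit_def funpow_comp\<close>)
    then show ?thesis using C(2) by simp
  qed
  \<comment> \<open>A finite string number would be at least its own successor.\<close>
  from this[of "Suc (the_enat (string_number (carrier G) f))"] show ?thesis
    by (cases "string_number (carrier G) f") auto
qed

lemma string_exists_if_string_number_pos:
  assumes "string_number \<Gamma> f > 0"
  obtains x where "is_string \<Gamma> f x"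
proof -
  obtain F where "ecard F > 0" "\<forall>x\<in>F. is_string \<Gamma> f x"
    using assms unfolding string_number_def less_Sup_iff by blast
  moreover from this have "F \<noteq> {}" by (auto simp: ecard_def zero_enat_def)
  ultimately show thesis using that by blast
qed

theorem theoremA:
  fixes G :: "('a, 'b) monoid_scheme" and \<phi> :: "'a \<Rightarrow> 'a"
  assumes "comm_group G" and "\<phi> \<in> hom G G"
  shows "(string_number (carrier G) \<phi> > 0 \<longleftrightarrow> string_number (carrier G) \<phi> = \<infinity>)
    \<and> (string_number (carrier G) \<phi> = \<infinity>
        \<longleftrightarrow> \<not> surjective_core (carrier G) \<phi> \<subseteq> Per (carrier G) \<phi>)"
proof -
  have "\<phi> ` carrier G \<subseteq> carrier G" using assms(2) by (auto simp: hom_def)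
  note core = surjective_core_eq_threads[OF this]
  have "\<not> surjective_core (carrier G) \<phi> \<subseteq> Per (carrier G) \<phi>"
    if pos: "string_number (carrier G) \<phi> > 0"
  proof -
    obtain x where x: "is_string (carrier G) \<phi> x"
      using string_exists_if_string_number_pos[OF pos] by blast
    then have thread: "x \<in> threads (carrier G) \<phi>" and "inj x" by (auto simp: is_string_iff)
    have "\<phi> ^^ p \<circ> x \<noteq> x" if "p > 0" for p
    proof
      assume "\<phi> ^^ p \<circ> x = x"
      then have "x p = x 0" using funpow_thread[OF thread, of p 0] by (metis add_0 comp_apply)
      then show False using \<open>inj x\<close> that by (simp add: inj_eq)
    qed
    then obtain N where "\<And>n. n \<ge> N \<Longrightarrow> x n \<notin> Per (carrier G) \<phi>"
      using aperiodic_thread_leaves_Per[OF thread] by blast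
    then have "x (N + 0) \<notin> Per (carrier G) \<phi>" by simp
    moreover have "x (N + 0) \<in> surjective_core (carrier G) \<phi>"
      unfolding core using tail_in_threads[OF thread, of N] by (rule rev_image_eqI) (rule refl)
    ultimately show ?thesis by blast
  qed
  moreover have "string_number (carrier G) \<phi> = \<infinity>"
    if notsub: "\<not> surjective_core (carrier G) \<phi> \<subseteq> Per (carrier G) \<phi>"
  proof -
    obtain x where x: "x \<in> threads (carrier G) \<phi>" "x 0 \<notin> Per (carrier G) \<phi>"
      using notsub unfolding core by blast
    have "\<phi> ^^ p \<circ> x \<noteq> x" if "p > 0" for p
    proof
      assume "\<phi> ^^ p \<circ> x = x"
      then have "(\<phi> ^^ p) (x 0) = x 0" by (metis comp_apply)
      then show False using x(2) that threadsD(1)[OF x(1)] unfolding Per_def by blast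
    qed
    then show ?thesis using string_number_infinite[OF assms x(1)] by blast
  qed
  moreover have "(0::enat) < \<infinity>" by simp
  ultimately show ?thesis by metis
qed

end
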